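(* Let $a,b,m,n$ be positive integers such that $a\leq b$, $a\leq m\leq n$, and $n>(a^2-a+1)(b-1)$. Then every properly edge-colored complete bipartite graph $K_{m,n}$ contains a rainbow $K_{a,b}$ subgraph; that is, $K_{m,n}\rightarrow_R K_{a,b}$.
   Context: $K_{m,n}$ denotes the complete bipartite graph with parts of sizes $m$ and $n$. An edge-coloring (with any number of colors) is proper if no two adjacent edges (edges sharing a vertex) have the same color. An edge-colored graph is rainbow if no two of its edges have the same color. $K_{m,n}\rightarrow_R K_{a,b}$ means that every proper edge-coloring of $K_{m,n}$ contains at least one rainbow subgraph isomorphic to $K_{a,b}$ (either part of $K_{a,b}$ may lie in either part of $K_{m,n}$). *)

theory Defs
  imports Main
begin

(* An undirected graph is a pair of a vertex set and a set of edges, an edge being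
   a two-element set of vertices. *)
type_synonym 'v graph = "'v set \<times> 'v set set"

abbreviation verts :: "'v graph \<Rightarrow> 'v set" where "verts \<equiv> fst"
abbreviation edges :: "'v graph \<Rightarrow> 'v set set" where "edges \<equiv> snd"

definition simple_graph :: "'v graph \<Rightarrow> bool" where
  "simple_graph G \<longleftrightarrow> (\<forall>e \<in> edges G. e \<subseteq> verts G \<and> card e = 2)"

definition subgraph :: "'v graph \<Rightarrow> 'v graph \<Rightarrow> bool" where
  "subgraph H G \<longleftrightarrow> simple_graph H \<and> verts H \<subseteq> verts G \<and> edges H \<subseteq> edges G"

definition isomorphic :: "'v graph \<Rightarrow> 'w graph \<Rightarrow> bool" where
  "isomorphic G H \<longleftrightarrow>
     (\<exists>f. bij_betw f (verts G) (verts H) \<and>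
          (\<forall>u \<in> verts G. \<forall>v \<in> verts G. {u, v} \<in> edges G \<longleftrightarrow> {f u, f v} \<in> edges H))"

definition complete_bipartite :: "nat \<Rightarrow> nat \<Rightarrow> (nat + nat) graph" where
  "complete_bipartite m n =
     (Inl ` {..<m} \<union> Inr ` {..<n}, {{Inl i, Inr j} | i j. i < m \<and> j < n})"

(* An edge-coloring is a function on vertex sets; only its values on edges matter. *)
definition proper_edge_coloring :: "'v graph \<Rightarrow> ('v set \<Rightarrow> 'c) \<Rightarrow> bool" where
  "proper_edge_coloring G c \<longleftrightarrow>
     (\<forall>e \<in> edges G. \<forall>e' \<in> edges G. e \<noteq> e' \<and> e \<inter> e' \<noteq> {} \<longrightarrow> c e \<noteq> c e')"

definition rainbow :: "('v set \<Rightarrow> 'c) \<Rightarrow> 'v graph \<Rightarrow> bool" where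
  "rainbow c H \<longleftrightarrow> inj_on c (edges H)"

(* The set of available colors is an arbitrary type 'c, passed explicitly because a
   definition cannot quantify over types. *)
definition rainbow_arrow :: "'c itself \<Rightarrow> 'v graph \<Rightarrow> 'w graph \<Rightarrow> bool" where
  "rainbow_arrow _ G H \<longleftrightarrow>
     (\<forall>c :: 'v set \<Rightarrow> 'c. proper_edge_coloring G c \<longrightarrow>
        (\<exists>S. subgraph S G \<and> isomorphic S H \<and> rainbow c S))"

end

theory Submission
  imports Defs
begin

text \<open>
  Fix any \<open>a\<close> rows (vertices of the left part); the rainbow copy is found by choosing \<open>b\<close> columns.
  Say that two columns conflict if some color occurs on both of them within the chosen rows.  A
  column \<open>j\<close> conflicts with few others: a conflict with \<open>k \<noteq> j\<close> is witnessed by a row \<open>r\<close> at \<open>j\<close> and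
  a row \<open>s\<close> at \<open>k\<close>; here \<open>s \<noteq> r\<close>, since colors do not repeat along a row, and for the same reason
  \<open>(r, s)\<close> determines \<open>k\<close>.  So there are at most \<open>a\<^sup>2 - a\<close> conflicting columns
  (\<open>card_conflicting_columns_le\<close>).  Choosing columns greedily, each choice excludes at most
  \<open>a\<^sup>2 - a + 1\<close> columns, so more than \<open>(a\<^sup>2 - a + 1) (b - 1)\<close> columns leave room for \<open>b\<close> pairwise
  non-conflicting ones (\<open>ex_independent_set\<close>).  On these the coloring is rainbow: within one
  column by properness, across columns because they do not conflict.
\<close>

text \<open>
  The greedy bound for a graph of maximum degree \<open>d\<close>: \<open>k\<close> chosen vertices together with their
  neighbors number at most \<open>(d + 1) k\<close>, so as long as this is less than the order of the graph,
  one more vertex can be chosen.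
\<close>

lemma ex_independent_set:
  assumes "finite V" and "symp R"
    and degree: "\<And>x. x \<in> V \<Longrightarrow> card {y \<in> V. y \<noteq> x \<and> R x y} \<le> d"
    and "(d + 1) * k < card V"
  shows "\<exists>S \<subseteq> V. card S = Suc k \<and> pairwise (\<lambda>x y. \<not> R x y) S"
proof -
  have "\<exists>S \<subseteq> V. card S = i \<and> pairwise (\<lambda>x y. \<not> R x y) S" if "i \<le> Suc k" for i
    using that
  proof (induction i)
    case 0
    show ?case by (intro exI[of _ "{}"]) simp
  next
    case (Suc i)
    then obtain S where S: "S \<subseteq> V" "card S = i" "pairwise (\<lambda>x y. \<not> R x y) S"
      by auto
    have "finite S" using S(1) \<open>finite V\<close> finite_subset by blast
    define N where "N x = insert x {y \<in> V. y \<noteq> x \<and> R x y}" for x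
    have "card (N x) \<le> d + 1" if "x \<in> S" for x
      using degree[of x] that S(1) \<open>finite V\<close> by (auto simp: N_def)
    then have "card (\<Union>x\<in>S. N x) \<le> (d + 1) * i"
      using card_UN_le[OF \<open>finite S\<close>, of N] sum_bounded_above[of S "\<lambda>x. card (N x)" "d + 1"] S(2)
      by (simp add: mult.commute)
    also have "\<dots> \<le> (d + 1) * k" using Suc.prems by (intro mult_le_mono2) simp
    also have "\<dots> < card V" by fact
    finally have "\<not> V \<subseteq> (\<Union>x\<in>S. N x)"
      using card_mono[of "\<Union>x\<in>S. N x" V] \<open>finite S\<close> \<open>finite V\<close> by (auto simp: N_def)
    then obtain v where v: "v \<in> V" "v \<notin> (\<Union>x\<in>S. N x)" by blast
    then have "v \<notin> S" "\<forall>x\<in>S. \<not> R x v" by (auto simp: N_def)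
    moreover from this have "\<forall>x\<in>S. \<not> R v x" using \<open>symp R\<close> by (auto dest: sympD)
    ultimately show ?case
      using S v(1) \<open>finite S\<close>
      by (intro exI[of _ "insert v S"]) (auto simp: pairwise_insert)
  qed
  then show ?thesis by blast
qed

text \<open>
  The color of column \<open>j\<close> in row \<open>r\<close> recurs at most once in each other row, and not at all in row \<open>r\<close>.
  The bound is the number of ordered pairs of distinct rows.
\<close>

lemma card_conflicting_columns_le:
  fixes f :: "nat \<Rightarrow> nat \<Rightarrow> 'c"
  assumes row: "\<And>r. r < a \<Longrightarrow> inj_on (f r) {..<n}" and "j < n"
  shows "card {k \<in> {..<n}. k \<noteq> j \<and> (\<exists>r<a. \<exists>s<a. f r j = f s k)} \<le> a\<^sup>2 - a"
    (is "card ?C \<le> _")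
proof -
  let ?P = "{..<a} \<times> {..<a} - (\<lambda>r. (r, r)) ` {..<a}"
  define K where "K p = {k \<in> {..<n}. f (fst p) j = f (snd p) k}" for p
  have "?C \<subseteq> (\<Union>p\<in>?P. K p)"
  proof
    fix k assume "k \<in> ?C"
    then obtain r s where k: "k < n" "k \<noteq> j" "r < a" "s < a" "f r j = f s k" by auto
    then have "r \<noteq> s" using inj_onD[OF row, of r j k] \<open>j < n\<close> by auto
    then have "(r, s) \<in> ?P" "k \<in> K (r, s)" using k by (auto simp: K_def)
    then show "k \<in> (\<Union>p\<in>?P. K p)" by (rule UN_I)
  qed
  moreover have "finite (\<Union>p\<in>?P. K p)" by (simp add: K_def)
  ultimately have "card ?C \<le> card (\<Union>p\<in>?P. K p)" by (rule card_mono[rotated])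
  also have "\<dots> \<le> (\<Sum>p\<in>?P. card (K p))"
    by (intro card_UN_le) simp
  also have "\<dots> \<le> (\<Sum>p\<in>?P. 1)"
  proof (intro sum_mono)
    fix p assume "p \<in> ?P"
    then have "snd p < a" by auto
    from row[OF this] have "\<forall>k\<in>K p. \<forall>k'\<in>K p. k = k'"
      by (simp add: K_def inj_on_def)
    moreover have "finite (K p)" by (simp add: K_def)
    ultimately show "card (K p) \<le> 1" by (simp add: card_le_Suc0_iff_eq)
  qed
  also have "\<dots> = a\<^sup>2 - a"
    by (subst sum_constant, subst card_Diff_subset)
      (auto simp: card_image inj_on_def power2_eq_square)
  finally show ?thesis .
qed

text \<open>
  Only the numbering of the columns has to be changed, so the isomorphism is the identity on the
  left part.
\<close>

lemma isomorphic_complete_bipartite_columns: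
  assumes "finite S" and "card S = b"
  shows "isomorphic (Inl ` {..<a} \<union> Inr ` S, {{Inl i, Inr j} | i j. i < a \<and> j \<in> S})
           (complete_bipartite a b)"
proof -
  obtain h where h: "bij_betw h S {..<b}"
    using ex_bij_betw_finite_nat[OF \<open>finite S\<close>] \<open>card S = b\<close> by (auto simp: atLeast0LessThan)
  have "h j < b" if "j \<in> S" for j
    using h that by (auto simp: bij_betw_def)
  moreover have "bij_betw (map_sum id h) (Inl ` {..<a} \<union> Inr ` S) (Inl ` {..<a} \<union> Inr ` {..<b})"
  proof (rule bij_betw_imageI)
    show "inj_on (map_sum id h) (Inl ` {..<a} \<union> Inr ` S)"
      using bij_betw_imp_inj_on[OF h] by (auto intro!: inj_onI dest: inj_onD)
    show "map_sum id h ` (Inl ` {..<a} \<union> Inr ` S) = Inl ` {..<a} \<union> Inr ` {..<b}"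
      using bij_betw_imp_surj_on[OF h] by (simp add: image_Un image_image flip: image_image[of Inr h])
  qed
  ultimately show ?thesis
    unfolding isomorphic_def complete_bipartite_def
    by (intro exI[of _ "map_sum id h"]) (auto simp: doubleton_eq_iff)
qed

theorem theorem2p1:
  fixes a b m n :: nat
  assumes "a > 0" and "b > 0" and "m > 0" and "n > 0"
    and "a \<le> b" and "a \<le> m" and "m \<le> n"
    and "n > (a\<^sup>2 - a + 1) * (b - 1)"
  shows "rainbow_arrow TYPE('c) (complete_bipartite m n) (complete_bipartite a b)"
  unfolding rainbow_arrow_def
proof (intro allI impI)
  fix c :: "(nat + nat) set \<Rightarrow> 'c"
  assume proper: "proper_edge_coloring (complete_bipartite m n) c"
  define f where "f i j = c {Inl i, Inr j}" for i j
  have adjacent: "f i j \<noteq> f i' j'"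
    if "i < m" "i' < m" "j < n" "j' < n" "(i, j) \<noteq> (i', j')" "i = i' \<or> j = j'" for i i' j j'
  proof -
    have "{Inl i, Inr j} \<noteq> {Inl i', Inr j'}" using that by (auto simp: doubleton_eq_iff)
    moreover have "{Inl i, Inr j} \<inter> {Inl i', Inr j'} \<noteq> {}" using that by auto
    moreover have "{Inl i, Inr j} \<in> edges (complete_bipartite m n)"
      "{Inl i', Inr j'} \<in> edges (complete_bipartite m n)"
      using that by (auto simp: complete_bipartite_def)
    ultimately show ?thesis
      using proper[unfolded proper_edge_coloring_def, rule_format, of "{Inl i, Inr j}" "{Inl i', Inr j'}"]
      by (simp add: f_def)
  qed
  have row: "inj_on (f r) {..<n}" if "r < a" for r
  proof (rule inj_onI)
    fix j k assume "j \<in> {..<n}" "k \<in> {..<n}" "f r j = f r k"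
    then show "j = k" using adjacent[of r r j k] that \<open>a \<le> m\<close> by auto
  qed
  define R where "R j k \<longleftrightarrow> (\<exists>r<a. \<exists>s<a. f r j = f s k)" for j k
  have "symp R" unfolding R_def by (rule sympI) metis
  moreover have "card {k \<in> {..<n}. k \<noteq> j \<and> R j k} \<le> a\<^sup>2 - a" if "j \<in> {..<n}" for j
    using card_conflicting_columns_le[OF row] that unfolding R_def by simp
  moreover have "(a\<^sup>2 - a + 1) * (b - 1) < card {..<n}" using assms by simp
  ultimately obtain S where S: "S \<subseteq> {..<n}" "card S = Suc (b - 1)" "pairwise (\<lambda>j k. \<not> R j k) S"
    using ex_independent_set[of "{..<n}" R "a\<^sup>2 - a" "b - 1"] by auto
  have "finite S" using S(1) finite_subset by blast
  have "card S = b" using S(2) \<open>b > 0\<close> by simp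
  let ?E = "{{Inl i, Inr j} | i j. i < a \<and> j \<in> S} :: (nat + nat) set set"
  let ?H = "(Inl ` {..<a} \<union> Inr ` S, ?E)"
  have "subgraph ?H (complete_bipartite m n)"
    unfolding subgraph_def
  proof (intro conjI)
    show "simple_graph ?H" by (auto simp: simple_graph_def)
    show "verts ?H \<subseteq> verts (complete_bipartite m n)"
      using S(1) \<open>a \<le> m\<close> by (auto simp: complete_bipartite_def)
    have "i < m" if "i < a" for i using that \<open>a \<le> m\<close> by simp
    moreover have "j < n" if "j \<in> S" for j using that S(1) by auto
    ultimately show "edges ?H \<subseteq> edges (complete_bipartite m n)"
      unfolding complete_bipartite_def snd_conv by blast
  qed
  moreover have "isomorphic ?H (complete_bipartite a b)"
    using \<open>finite S\<close> \<open>card S = b\<close> by (rule isomorphic_complete_bipartite_columns)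
  moreover have "rainbow c ?H"
  proof -
    have "i = i' \<and> j = j'"
      if "i < a" "i' < a" "j \<in> S" "j' \<in> S" "f i j = f i' j'" for i i' j j'
    proof (rule ccontr)
      assume "\<not> (i = i' \<and> j = j')"
      moreover have "j = j'"
        using S(3) that unfolding pairwise_def R_def by blast
      ultimately show False
        using adjacent[of i i' j j'] that S(1) \<open>a \<le> m\<close> by auto
    qed
    then show ?thesis unfolding rainbow_def inj_on_def f_def by fastforce
  qed
  ultimately show "\<exists>H. subgraph H (complete_bipartite m n) \<and>
      isomorphic H (complete_bipartite a b) \<and> rainbow c H"
    by blast
qed

end
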